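(* Let $\Theta$ be a set and let $M:\Theta\to\mathbb{S}^{n,n+m}$ be a mapping with $M_{22}(\theta)\le 0$ for all $\theta\in\Theta$. Let $Q\in\mathbb{S}^{n,n+m}$ be the data-dependent matrix defined in the context. Then the data $\mathcal{D}=(U_-,X)$ are informative for $M$-control with respect to $\mathcal{W}_{\mathrm F}(\Phi)$ if and only if there exist a $\theta\in\Theta$ and scalars $\alpha\ge 0$ and $\beta>0$ such that $$M(\theta)-\alpha Q\ \ge\ \begin{bmatrix}\beta I_n&0\\ 0&0\end{bmatrix}.$$
   Context: Notation. All matrices are real. $\mathbb{S}^n$: symmetric $n\times n$ matrices; $\ge,>,\le,<$ between symmetric matrices refer to (semi)definiteness. $\mathbb{S}^{p,q}$: symmetric $(p+q)\times(p+q)$ matrices partitioned as $\Pi=\begin{bmatrix}\Pi_{11}&\Pi_{12}\\ \Pi_{21}&\Pi_{22}\end{bmatrix}$ with $\Pi_{11}\in\mathbb{S}^p$, $\Pi_{22}\in\mathbb{S}^q$. $Y^\dagger$ is the Moore-Penrose pseudoinverse, $\otimes$ the Kronecker product, $\operatorname{vec}(Y)$ the column-stacking vectorization. $\Pi|\Pi_{22}:=\Pi_{11}-\Pi_{12}\Pi_{22}^{\dagger}\Pi_{21}$, and $\mathbf{\Pi}_{p,q}:=\{\Pi\in\mathbb{S}^{p,q}\mid \Pi_{22}\le 0,\ \ker\Pi_{22}\subseteq\ker\Pi_{12},\ \Pi|\Pi_{22}\ge 0\}$. Data and noise model. Let $n,m,T$ be positive integers. The data $\mathcal{D}=(U_-,X)$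 consist of $U_-=[u(0)\ \cdots\ u(T-1)]\in\mathbb{R}^{m\times T}$ and $X=[x(0)\ \cdots\ x(T)]\in\mathbb{R}^{n\times(T+1)}$; put $X_-=[x(0)\ \cdots\ x(T-1)]$, $X_+=[x(1)\ \cdots\ x(T)]$. Let $\Phi\in\mathbf{\Pi}_{1,nT}$ be given, with $\Phi_{22}=\phi\otimes I_n$ for some $\phi\in\mathbb{S}^T$, and let $$\mathcal{W}_{\mathrm F}(\Phi):=\Big\{W\in\mathbb{R}^{n\times T}\ \Big|\ \begin{bmatrix}1\\ \operatorname{vec}(W)\end{bmatrix}^{\top}\Phi\begin{bmatrix}1\\ \operatorname{vec}(W)\end{bmatrix}\ge 0\Big\}.$$ The set of data-compatible systems is $\Sigma_{\mathcal D}(\mathcal{W}_{\mathrm F}(\Phi)):=\{(A,B)\in\mathbb{R}^{n\times n}\times\mathbb{R}^{n\times m}\mid X_+=AX_-+BU_-+W\text{ for some }W\in\mathcal{W}_{\mathrm F}(\Phi)\}$. The data are generated by a true (unknown) system $(A_s,B_s)$ with noise matrix in $\mathcal{W}_{\mathrm F}(\Phi)$, i.e. $(A_s,B_s)\in\Sigma_{\mathcal D}(\mathcal{W}_{\mathrm F}(\Phi))$. Informativity. For a set $\Theta$ and $M:\Theta\to\mathbb{S}^{n,n+m}$ with $M_{22}(\theta)\le0$ for all $\theta$, the data are informative for $M$-control with respect to $\mathcal{W}_{\mathrm F}(\Phi)$ if there exists $\theta\in\Theta$ such that $$\begin{bmatrix}I\\ A^\top\\ B^\top\end{bmatrix}^{\top}M(\theta)\begin{bmatrix}I\\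 A^\top\\ B^\top\end{bmatrix}>0\quad\text{for all }(A,B)\in\Sigma_{\mathcal D}(\mathcal{W}_{\mathrm F}(\Phi)).$$ The matrices $N$ and $Q$. Let $$E:=\begin{bmatrix}1&0\\ \operatorname{vec}(X_+)&-\begin{bmatrix}X_-\\ U_-\end{bmatrix}^{\top}\otimes I_n\end{bmatrix},\qquad N:=E^{\top}\Phi E\in\mathbb{S}^{1,n(n+m)},$$ $$Q_{22}:=\begin{bmatrix}X_-\\ U_-\end{bmatrix}\phi\begin{bmatrix}X_-\\ U_-\end{bmatrix}^{\top},\qquad Q:=\begin{bmatrix}(N|N_{22})I_n+Q_{12}Q_{22}^{\dagger}Q_{21}&Q_{12}\\ Q_{21}&Q_{22}\end{bmatrix}\in\mathbb{S}^{n,n+m},$$ where $Q_{12}\in\mathbb{R}^{n\times(n+m)}$ is determined by $\operatorname{vec}(Q_{12})=N_{21}$ and $Q_{21}=Q_{12}^\top$. *)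

theory Defs
  imports "HOL-Analysis.Analysis"
begin

section \<open>Block matrices\<close>

text \<open>A matrix partitioned into p + q rows and r + s columns is indexed by sum types.\<close>

definition block_matrix ::
  "real^'r^'p \<Rightarrow> real^'s^'p \<Rightarrow> real^'r^'q \<Rightarrow> real^'s^'q \<Rightarrow> real^('r + 's)^('p + 'q)" where
  "block_matrix A B C D = (\<chi> i j. case i of
      Inl a \<Rightarrow> (case j of Inl b \<Rightarrow> A $ a $ b | Inr b \<Rightarrow> B $ a $ b)
    | Inr a \<Rightarrow> (case j of Inl b \<Rightarrow> C $ a $ b | Inr b \<Rightarrow> D $ a $ b))"

definition block11 :: "real^('r::finite + 's::finite)^('p::finite + 'q::finite) \<Rightarrow> real^'r^'p" where
  "block11 P = (\<chi> i j. P $ Inl i $ Inl j)"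

definition block12 :: "real^('r::finite + 's::finite)^('p::finite + 'q::finite) \<Rightarrow> real^'s^'p" where
  "block12 P = (\<chi> i j. P $ Inl i $ Inr j)"

definition block21 :: "real^('r::finite + 's::finite)^('p::finite + 'q::finite) \<Rightarrow> real^'r^'q" where
  "block21 P = (\<chi> i j. P $ Inr i $ Inl j)"

definition block22 :: "real^('r::finite + 's::finite)^('p::finite + 'q::finite) \<Rightarrow> real^'s^'q" where
  "block22 P = (\<chi> i j. P $ Inr i $ Inr j)"

definition vstack :: "real^'r^'p \<Rightarrow> real^'r^'q \<Rightarrow> real^'r^('p + 'q)" where
  "vstack A B = (\<chi> i. case i of Inl a \<Rightarrow> A $ a | Inr b \<Rightarrow> B $ b)"

lemma block_matrix_inverse:
  "block11 (block_matrix A B C D) = A" "block12 (block_matrix A B C D) = B"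
  "block21 (block_matrix A B C D) = C" "block22 (block_matrix A B C D) = D"
  "block_matrix (block11 P) (block12 P) (block21 P) (block22 P) = P"
  by (auto simp: block_matrix_def block11_def block12_def block21_def block22_def
      vec_eq_iff split: sum.split)


section \<open>Definiteness\<close>

definition symmetric_matrix :: "real^'n^'n \<Rightarrow> bool" where
  "symmetric_matrix A \<longleftrightarrow> transpose A = A"

definition pos_semidef :: "real^'n^'n \<Rightarrow> bool" where
  "pos_semidef A \<longleftrightarrow> symmetric_matrix A \<and> (\<forall>x. 0 \<le> x \<bullet> (A *v x))"

definition pos_def :: "real^'n^'n \<Rightarrow> bool" where
  "pos_def A \<longleftrightarrow> symmetric_matrix A \<and> (\<forall>x. x \<noteq> 0 \<longrightarrow> 0 < x \<bullet> (A *v x))"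

text \<open>The library order \<open>\<le>\<close> on \<open>real^'n^'n\<close> is entrywise, hence a separate symbol.\<close>

definition loewner_le :: "real^'n^'n \<Rightarrow> real^'n^'n \<Rightarrow> bool" (infix "\<preceq>" 50) where
  "A \<preceq> B \<longleftrightarrow> pos_semidef (B - A)"


section \<open>Moore-Penrose pseudoinverse\<close>

definition is_pseudoinverse :: "real^'n^'m \<Rightarrow> real^'m^'n \<Rightarrow> bool" where
  "is_pseudoinverse A Z \<longleftrightarrow> A ** Z ** A = A \<and> Z ** A ** Z = Z \<and>
     transpose (A ** Z) = A ** Z \<and> transpose (Z ** A) = Z ** A"

definition pseudoinverse :: "real^'n^'m \<Rightarrow> real^'m^'n" where
  "pseudoinverse A = (THE Z. is_pseudoinverse A Z)"

lemma is_pseudoinverse_unique: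
  assumes Y: "is_pseudoinverse A Y" and Z: "is_pseudoinverse A Z"
  shows "Y = Z"
proof -
  have AY: "A ** Y = A ** Z"
  proof -
    have "A ** Y = transpose (A ** Z ** A ** Y)"
      using Y Z unfolding is_pseudoinverse_def by metis
    also have "\<dots> = transpose ((A ** Z) ** (A ** Y))" by (simp add: matrix_mul_assoc)
    also have "\<dots> = (A ** Y) ** (A ** Z)"
      using Y Z unfolding is_pseudoinverse_def by (metis matrix_transpose_mul)
    also have "\<dots> = A ** Z"
      using Y unfolding is_pseudoinverse_def by (metis matrix_mul_assoc)
    finally show ?thesis .
  qed
  have YA: "Y ** A = Z ** A"
  proof -
    have "Y ** A = transpose (Y ** (A ** Z ** A))"
      using Y Z unfolding is_pseudoinverse_def by metis
    also have "\<dots> = transpose ((Y ** A) ** (Z ** A))" by (simp add: matrix_mul_assoc)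
    also have "\<dots> = (Z ** A) ** (Y ** A)"
      using Y Z unfolding is_pseudoinverse_def by (metis matrix_transpose_mul)
    also have "\<dots> = Z ** (A ** Y ** A)" by (simp add: matrix_mul_assoc)
    also have "\<dots> = Z ** A"
      using Y unfolding is_pseudoinverse_def by metis
    finally show ?thesis .
  qed
  show ?thesis
    using Y Z AY YA unfolding is_pseudoinverse_def by (metis matrix_mul_assoc)
qed

lemma ginverse_exists: "\<exists>B. A ** B ** A = (A :: real^'n^'m)"
proof -
  obtain g where g: "linear g" "\<And>v. v \<in> range ((*v) A) \<Longrightarrow> A *v g v = v"
    using real_vector.linear_exists_right_inverse_on[of "(*v) A" UNIV] by auto
  have "A ** matrix g ** A = A"
    by (rule iffD2[OF matrix_eq])
      (simp add: matrix_vector_mul_assoc[symmetric] matrix_works[OF g(1)[folded linear_matrix_vector_mul_eq]] g(2))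
  then show ?thesis by blast
qed

lemma gram_cancel:
  fixes A :: "real^'n^'m"
  assumes "transpose A ** A ** Y = transpose A ** A ** Z"
  shows "A ** Y = A ** (Z :: real^'k^'n)"
proof (rule iffD2[OF matrix_eq], rule allI)
  fix x
  define w where "w = Y *v x - Z *v x"
  have "transpose A *v (A *v w) = 0"
    using assms unfolding w_def
    by (metis matrix_vector_mul_assoc matrix_vector_mult_diff_distrib right_minus_eq)
  then have "(A *v w) \<bullet> (A *v w) = 0"
    by (metis dot_lmul_matrix inner_zero_left transpose_matrix_vector)
  then show "A ** Y *v x = A ** Z *v x"
    by (simp add: w_def matrix_vector_mult_diff_distrib matrix_vector_mul_assoc)
qed

lemma is_pseudoinverse_exists: "\<exists>Z. is_pseudoinverse (A :: real^'n^'m) Z"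
proof -
  have half: "\<exists>G. B ** G ** B = B \<and> transpose (B ** G) = B ** G" for B :: "real^'k^'l"
  proof -
    obtain H where H: "transpose B ** B ** H ** (transpose B ** B) = transpose B ** B"
      using ginverse_exists by blast
    define G where "G = H ** transpose B"
    have 1: "B ** (G ** B) = B ** mat 1"
      by (rule gram_cancel) (use H in \<open>simp add: G_def matrix_mul_assoc\<close>)
    then have 1: "B ** G ** B = B" by (simp add: matrix_mul_assoc)
    then have "transpose (B ** G) = transpose (B ** G) ** (B ** G)"
    proof -
      have "transpose B = transpose B ** transpose (B ** G)"
        using 1 by (metis matrix_transpose_mul)
      have "B ** G = B ** H ** transpose B" by (simp add: G_def matrix_mul_assoc)
      also have "\<dots> = B ** H ** (transpose B ** transpose (B ** G))"
        using \<open>transpose B = _\<close> by simp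
      also have "\<dots> = B ** G ** transpose (B ** G)" by (simp add: G_def matrix_mul_assoc)
      finally show ?thesis by (metis matrix_transpose_mul transpose_transpose)
    qed
    then have "transpose (B ** G) = B ** G" 
      by (metis matrix_transpose_mul transpose_transpose)
    with 1 show ?thesis by blast
  qed
  obtain G where G: "A ** G ** A = A" "transpose (A ** G) = A ** G" using half by blast
  obtain K where "transpose A ** K ** transpose A = transpose A"
      "transpose (transpose A ** K) = transpose A ** K" using half by blast
  then obtain F where F: "A ** F ** A = A" "transpose (F ** A) = F ** A"
    by (metis matrix_mul_assoc matrix_transpose_mul transpose_transpose)
  have "A ** (F ** A ** G) = A ** G" using F by (simp add: matrix_mul_assoc)
  moreover have "(F ** A ** G) ** A = F ** A" using G by (metis matrix_mul_assoc)
  ultimately have "is_pseudoinverse A (F ** A ** G)"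
    using F G unfolding is_pseudoinverse_def by (metis matrix_mul_assoc)
  then show ?thesis by blast
qed

lemma is_pseudoinverse_pseudoinverse: "is_pseudoinverse A (pseudoinverse A)"
  unfolding pseudoinverse_def
  using is_pseudoinverse_exists is_pseudoinverse_unique by (metis theI)


section \<open>Generalized Schur complement\<close>

definition schur :: "real^('p::finite + 'q::finite)^('p + 'q) \<Rightarrow> real^'p^'p" where
  "schur P = block11 P - block12 P ** pseudoinverse (block22 P) ** block21 P"

definition Pi_set :: "(real^('p::finite + 'q::finite)^('p + 'q)) set" where
  "Pi_set = {P. symmetric_matrix P \<and> block22 P \<preceq> 0 \<and>
     {v. block22 P *v v = 0} \<subseteq> {v. block12 P *v v = 0} \<and> 0 \<preceq> schur P}"


section \<open>Vectorization and Kronecker product\<close>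

text \<open>
  Column stacking: the entry in row i and column j sits at position (j, i), so that pairs in
  lexicographic order enumerate the columns one after the other. The Kronecker product uses the
  same convention, the first component selecting the block.
\<close>

definition vectorize :: "real^'c^'r \<Rightarrow> real^('c \<times> 'r)" where
  "vectorize A = (\<chi> p. A $ snd p $ fst p)"

definition unvectorize :: "real^('c::finite \<times> 'r::finite) \<Rightarrow> real^'c^'r" where
  "unvectorize v = (\<chi> i j. v $ (j, i))"

lemma vectorize_inverse: "vectorize (unvectorize v) = v" "unvectorize (vectorize A) = A"
  by (simp_all add: vectorize_def unvectorize_def vec_eq_iff)

definition kronecker :: "real^'b^'a \<Rightarrow> real^'d^'c \<Rightarrow> real^('b \<times> 'd)^('a \<times> 'c)"
    (infixl "\<otimes>\<^sub>K" 70) where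
  "A \<otimes>\<^sub>K B = (\<chi> p q. A $ fst p $ fst q * B $ snd p $ snd q)"


section \<open>Data\<close>

text \<open>
  The index type \<open>'t\<close> stands for the time instants 0, ..., T - 1 with T = CARD('t); its elements
  are numbered along the linear order. A signal is a function on the naturals, of which only the
  first T (inputs) or T + 1 (states) samples matter.
\<close>

definition time_index :: "'t::{finite,linorder} \<Rightarrow> nat" where
  "time_index t = card {s. s < t}"

lemma time_index_bij: "bij_betw time_index (UNIV :: 't::{finite,linorder} set) {..<CARD('t)}"
proof -
  have inj: "inj (time_index :: 't \<Rightarrow> nat)"
  proof (rule linorder_injI)
    fix s t :: 't assume "s < t"
    then have "{r. r < s} \<subset> {r. r < t}" by auto
    then show "time_index s \<noteq> time_index t"
      unfolding time_index_def by (metis finite nat_neq_iff psubset_card_mono)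
  qed
  have "time_index t < CARD('t)" for t :: 't
    unfolding time_index_def by (rule psubset_card_mono) auto
  then have "range (time_index :: 't \<Rightarrow> nat) \<subseteq> {..<CARD('t)}" by auto
  moreover have "card (range (time_index :: 't \<Rightarrow> nat)) = card {..<CARD('t)}"
    using inj by (simp add: card_image)
  ultimately show ?thesis
    using inj unfolding bij_betw_def by (metis card_subset_eq finite_lessThan)
qed

definition past :: "(nat \<Rightarrow> real^'k) \<Rightarrow> real^'t::{finite,linorder}^'k" where
  "past z = (\<chi> i t. z (time_index t) $ i)"

definition future :: "(nat \<Rightarrow> real^'k) \<Rightarrow> real^'t::{finite,linorder}^'k" where
  "future z = (\<chi> i t. z (Suc (time_index t)) $ i)"

definition one_vec :: "real^'t^'n \<Rightarrow> real^1^(1 + 't \<times> 'n)" where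
  "one_vec W = vstack (mat 1) (columnvector (vectorize W))"

definition noise_set :: "real^(1 + 't \<times> 'n)^(1 + 't \<times> 'n) \<Rightarrow> (real^'t^'n) set" where
  "noise_set \<Phi> = {W. 0 \<preceq> transpose (one_vec W) ** \<Phi> ** one_vec W}"

definition compatible_systems ::
  "(nat \<Rightarrow> real^'m) \<Rightarrow> (nat \<Rightarrow> real^'n) \<Rightarrow> (real^'t::{finite,linorder}^'n) set \<Rightarrow>
   ((real^'n^'n) \<times> (real^'m^'n)) set" where
  "compatible_systems u x \<W> =
     {(A, B). \<exists>W\<in>\<W>. future x = A ** past x + B ** past u + W}"

definition informative ::
  "(nat \<Rightarrow> real^'m) \<Rightarrow> (nat \<Rightarrow> real^'n) \<Rightarrow> (real^'t::{finite,linorder}^'n) set \<Rightarrow>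
   'a set \<Rightarrow> ('a \<Rightarrow> real^('n + ('n + 'm))^('n + ('n + 'm))) \<Rightarrow> bool" where
  "informative u x \<W> \<Theta> M \<longleftrightarrow> (\<exists>\<theta>\<in>\<Theta>. \<forall>(A, B) \<in> compatible_systems u x \<W>.
     pos_def (transpose (vstack (mat 1) (vstack (transpose A) (transpose B))) ** M \<theta> **
       vstack (mat 1) (vstack (transpose A) (transpose B))))"


section \<open>The data-dependent matrices\<close>

definition E_matrix ::
  "(nat \<Rightarrow> real^'m) \<Rightarrow> (nat \<Rightarrow> real^'n) \<Rightarrow>
   real^(1 + ('n + 'm) \<times> 'n)^(1 + 't::{finite,linorder} \<times> 'n)" where
  "E_matrix u x = block_matrix
     (mat 1) 0
     (columnvector (vectorize (future x))) (- (transpose (vstack (past x) (past u)) \<otimes>\<^sub>K mat 1))"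

definition N_matrix ::
  "(nat \<Rightarrow> real^'m) \<Rightarrow> (nat \<Rightarrow> real^'n) \<Rightarrow>
   real^(1 + 't::{finite,linorder} \<times> 'n)^(1 + 't \<times> 'n) \<Rightarrow>
   real^(1 + ('n + 'm) \<times> 'n)^(1 + ('n + 'm) \<times> 'n)" where
  "N_matrix u x \<Phi> = transpose (E_matrix u x) ** \<Phi> ** E_matrix u x"

definition Q12 ::
  "(nat \<Rightarrow> real^'m) \<Rightarrow> (nat \<Rightarrow> real^'n) \<Rightarrow>
   real^(1 + 't::{finite,linorder} \<times> 'n)^(1 + 't \<times> 'n) \<Rightarrow> real^('n + 'm)^'n" where
  "Q12 u x \<Phi> = unvectorize (column 1 (block21 (N_matrix u x \<Phi>)))"

lemma vec_Q12: "columnvector (vectorize (Q12 u x \<Phi>)) = block21 (N_matrix u x \<Phi>)"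
  unfolding Q12_def vectorize_inverse
  by (simp add: columnvector_def column_def vec_eq_iff forall_1)

definition Q22 ::
  "(nat \<Rightarrow> real^'m) \<Rightarrow> (nat \<Rightarrow> real^'n) \<Rightarrow> real^'t::{finite,linorder}^'t::{finite,linorder} \<Rightarrow>
   real^('n + 'm)^('n + 'm)" where
  "Q22 u x \<phi> = vstack (past x) (past u) ** \<phi> ** transpose (vstack (past x) (past u))"

definition Q_matrix ::
  "(nat \<Rightarrow> real^'m) \<Rightarrow> (nat \<Rightarrow> real^'n) \<Rightarrow>
   real^(1 + 't::{finite,linorder} \<times> 'n)^(1 + 't \<times> 'n) \<Rightarrow> real^'t::{finite,linorder}^'t::{finite,linorder} \<Rightarrow>
   real^('n + ('n + 'm))^('n + ('n + 'm))" where
  "Q_matrix u x \<Phi> \<phi> = block_matrix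
     (schur (N_matrix u x \<Phi>) $ 1 $ 1 *\<^sub>R mat 1 +
        Q12 u x \<Phi> ** pseudoinverse (Q22 u x \<phi>) ** transpose (Q12 u x \<Phi>))
     (Q12 u x \<Phi>)
     (transpose (Q12 u x \<Phi>)) (Q22 u x \<phi>)"

end

theory Submission
  imports Defs
begin

text \<open>
  Write \<open>Z = [A B]\<close>. Completing the square in the noise inequality shows that \<open>(A, B)\<close> is compatible
  iff \<open>0 \<le> s + tr (D Q\<^sub>2\<^sub>2 D\<^sup>T)\<close> with \<open>D = Z + Q\<^sub>1\<^sub>2 Q\<^sub>2\<^sub>2\<^sup>\<dagger>\<close> and \<open>s = N|N\<^sub>2\<^sub>2\<close>: a ball in a Frobenius
  seminorm. The form of \<open>Q\<close> at \<open>(v, Z\<^sup>T v)\<close> is \<open>s |v|\<^sup>2 + d \<bullet> Q\<^sub>2\<^sub>2 d\<close> with \<open>d = D\<^sup>T v\<close>. For a fixed \<open>v\<close> the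
  vectors \<open>D\<^sup>T v\<close> obtained from the ball are exactly those with \<open>0 \<le> s |v|\<^sup>2 + d \<bullet> Q\<^sub>2\<^sub>2 d\<close>, because
  rank-one matrices \<open>D\<close> suffice to reach them. So informativity says that the form of \<open>M\<close> is positive
  at every \<open>(v, w)\<close> with \<open>v \<noteq> 0\<close> at which the form of \<open>Q\<close> is nonnegative, and an S-lemma yields the
  multipliers. No Slater point is needed: the S-lemma is strict, once the common null directions
  \<open>(0, w)\<close> with \<open>Q\<^sub>2\<^sub>2 w = 0\<close> have been divided out.
\<close>

declare transpose_matrix_vector [simp del]

section \<open>Quadratic forms\<close>

text \<open>If \<open>b\<close> is nonzero, the affine part vanishes at \<open>t = - c / b\<close>
  and leaves a nonpositive value. With \<open>b = 0\<close>, a negative \<open>a\<close> gives the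
  real root \<open>sqrt (- c / a)\<close>.\<close>

lemma quadratic_pos_imp:
  fixes a b c :: real
  assumes "\<And>t. c + b * t + a * t\<^sup>2 > 0" and "a \<le> 0"
  shows "a = 0" and "b = 0"
proof -
  show b: "b = 0"
  proof (rule ccontr)
    assume "b \<noteq> 0"
    have "c + b * (- c / b) + a * (- c / b)\<^sup>2 > 0" using assms(1) .
    moreover have "a * (- c / b)\<^sup>2 \<le> 0" using assms(2) by (simp add: mult_nonpos_nonneg)
    ultimately show False using \<open>b \<noteq> 0\<close> by simp
  qed
  show "a = 0"
  proof (rule ccontr)
    assume "a \<noteq> 0"
    then have "a < 0" using assms(2) by simp
    have c: "c > 0" using assms(1)[of 0] by simp
    have "c + b * sqrt (- c / a) + a * (sqrt (- c / a))\<^sup>2 > 0" using assms(1) .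
    moreover have "(sqrt (- c / a))\<^sup>2 = - c / a"
      using c \<open>a < 0\<close> by (simp add: divide_nonneg_nonpos)
    ultimately show False using b \<open>a < 0\<close> by simp
  qed
qed

lemma symmetric_inner_commute:
  assumes "symmetric_matrix A"
  shows "x \<bullet> (A *v y) = y \<bullet> (A *v x)"
  using assms unfolding symmetric_matrix_def
  by (metis dot_lmul_matrix inner_commute transpose_matrix_vector)

lemma quadratic_form_add_scaleR:
  assumes "symmetric_matrix A"
  shows "(x + t *\<^sub>R y) \<bullet> (A *v (x + t *\<^sub>R y)) =
    x \<bullet> (A *v x) + 2 * (x \<bullet> (A *v y)) * t + (y \<bullet> (A *v y)) * t\<^sup>2"
  using symmetric_inner_commute[OF assms, of x y]
  by (simp add: matrix_vector_right_distrib matrix_vector_mult_scaleR inner_add_left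
      inner_add_right power2_eq_square algebra_simps)

lemma quadratic_form_scaleR:
  fixes A :: "real^'n^'n"
  shows "(c *\<^sub>R y) \<bullet> (A *v (c *\<^sub>R y)) = c\<^sup>2 * (y \<bullet> (A *v y))"
  by (simp add: matrix_vector_mult_scaleR power2_eq_square)

lemma matrix_vector_mult_uminus: "A *v (- x) = - (A *v x)" for A :: "real^'n^'m"
  using matrix_vector_mult_diff_distrib[of A 0 x] by simp

lemma uminus_matrix_vector_mult: "(- A) *v x = - (A *v x)" for A :: "real^'n^'m"
  using matrix_vector_mult_diff_rdistrib[of 0 A x] by simp

lemma transpose_plus: "transpose (A + B) = transpose A + transpose B"
  by (simp add: transpose_def vec_eq_iff)

lemma transpose_minus: "transpose (A - B) = transpose A - transpose B"
  by (simp add: transpose_def vec_eq_iff)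

text \<open>Moving from \<open>A *v x\<close> in the direction \<open>x\<close> gives a form that is
  affine in the parameter, with slope twice the squared norm of \<open>A *v x\<close>. An affine
  function that is nonnegative everywhere has slope zero.\<close>

lemma pos_semidef_null_vector:
  assumes "pos_semidef A" and "x \<bullet> (A *v x) = 0"
  shows "A *v x = 0"
proof -
  have sym: "symmetric_matrix A" and nn: "\<And>z. 0 \<le> z \<bullet> (A *v z)"
    using assms(1) by (auto simp: pos_semidef_def)
  define z where "z = A *v x"
  have "0 \<le> z \<bullet> (A *v z) + 2 * (z \<bullet> z) * t" for t
    using nn[of "z + t *\<^sub>R x"] assms(2) quadratic_form_add_scaleR[OF sym, of z t x]
    by (simp add: z_def)
  \<comment> \<open>At this parameter the affine function would take the value -1.\<close>
  from this[of "- (1 + z \<bullet> (A *v z)) / (2 * (z \<bullet> z))"] have "z \<bullet> z = 0"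
    using nn[of z] by (cases "z \<bullet> z = 0") (auto simp: field_simps)
  then show ?thesis by (simp add: z_def)
qed

lemma loewner_le_zeroD:
  assumes "A \<preceq> 0"
  shows "symmetric_matrix A" and "x \<bullet> (A *v x) \<le> 0"
    and "x \<bullet> (A *v x) = 0 \<Longrightarrow> A *v x = 0"
proof -
  have psd: "pos_semidef (- A)" using assms by (simp add: loewner_le_def)
  show "symmetric_matrix A"
    using psd by (simp add: pos_semidef_def symmetric_matrix_def transpose_def vec_eq_iff)
  show "x \<bullet> (A *v x) \<le> 0" using psd by (auto simp: pos_semidef_def uminus_matrix_vector_mult)
  show "A *v x = 0" if "x \<bullet> (A *v x) = 0"
    using pos_semidef_null_vector[OF psd, of x] that by (simp add: uminus_matrix_vector_mult)
qed

section \<open>The S-lemma on a subspace\<close>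

lemma continuous_on_quadratic_form:
  fixes A :: "real^'n^'n"
  shows "continuous_on S (\<lambda>x. x \<bullet> (A *v x))"
  by (intro continuous_intros linear_continuous_on matrix_vector_mul_bounded_linear)

text \<open>
  A negative and a positive direction of \<open>Q\<close> span a plane in which \<open>Q\<close> vanishes on two lines. The
  form of \<open>M\<close> is positive on both, and a suitable combination of these two inequalities has no
  cross term.
\<close>

lemma quadratic_form_ratio_less:
  assumes sym: "symmetric_matrix M" "symmetric_matrix Q" and V: "subspace V"
    and pos: "\<And>y. y \<in> V \<Longrightarrow> y \<noteq> 0 \<Longrightarrow> 0 \<le> y \<bullet> (Q *v y) \<Longrightarrow> 0 < y \<bullet> (M *v y)"
    and y: "y \<in> V" "y \<bullet> (Q *v y) < 0" and z: "z \<in> V" "z \<bullet> (Q *v z) > 0"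
  shows "(y \<bullet> (M *v y)) / (y \<bullet> (Q *v y)) < (z \<bullet> (M *v z)) / (z \<bullet> (Q *v z))"
proof -
  define a b c where "a = - (y \<bullet> (Q *v y))" and "b = z \<bullet> (Q *v y)" and "c = z \<bullet> (Q *v z)"
  define r where "r = sqrt (b\<^sup>2 + a * c)"
  \<comment> \<open>The form of \<open>Q\<close> at \<open>z + t *\<^sub>R y\<close> is
    \<open>c + 2 * b * t - a * t\<^sup>2\<close>; these are its two roots, of opposite
    signs.\<close>
  define t1 t2 where "t1 = (b - r) / a" and "t2 = (b + r) / a"
  have a: "a > 0" and c: "c > 0" using y z by (simp_all add: a_def c_def)
  then have r2: "r\<^sup>2 = b\<^sup>2 + a * c" by (simp add: r_def add_nonneg_nonneg)
  have r: "r > \<bar>b\<bar>"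
    unfolding r_def by (rule real_less_rsqrt) (use a c in simp)
  have t: "t1 < 0" "t2 > 0" using r a by (auto simp: t1_def t2_def divide_simps)
  have prod: "t1 * t2 = - c / a"
    using a r2 by (simp add: t1_def t2_def field_simps power2_eq_square)
  have root: "c + 2 * b * t + - a * t\<^sup>2 = 0" if "t = t1 \<or> t = t2" for t
  proof -
    have "a * t - b = - r \<or> a * t - b = r" using that a by (auto simp: t1_def t2_def)
    then have "(a * t - b)\<^sup>2 = r\<^sup>2" by auto
    then have "a * (c + 2 * b * t + - a * t\<^sup>2) = 0"
      unfolding r2 by (simp add: power2_eq_square algebra_simps)
    then show ?thesis using a by simp
  qed
  have M: "0 < z \<bullet> (M *v z) + 2 * (z \<bullet> (M *v y)) * t + (y \<bullet> (M *v y)) * t\<^sup>2"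
    if "t = t1 \<or> t = t2" for t
  proof -
    have Q0: "(z + t *\<^sub>R y) \<bullet> (Q *v (z + t *\<^sub>R y)) = 0"
      using root[OF that] by (simp add: quadratic_form_add_scaleR[OF sym(2)] a_def b_def c_def)
    have "z + t *\<^sub>R y \<noteq> 0"
    proof
      assume "z + t *\<^sub>R y = 0"
      then have "z = (- t) *\<^sub>R y" by (simp add: eq_neg_iff_add_eq_0)
      then have "z \<bullet> (Q *v z) = (- t)\<^sup>2 * (y \<bullet> (Q *v y))" by (simp only: quadratic_form_scaleR)
      then show False using y z by (smt (verit) mult_nonneg_nonpos zero_le_power2)
    qed
    then show ?thesis
      using pos[of "z + t *\<^sub>R y"] Q0 V y z
      by (simp add: quadratic_form_add_scaleR[OF sym(1)] subspace_add subspace_scale)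
  qed
  \<comment> \<open>The positive weights \<open>t2\<close> and \<open>- t1\<close> cancel the terms
    linear in the parameter.\<close>
  have "0 < t2 * (z \<bullet> (M *v z) + 2 * (z \<bullet> (M *v y)) * t1 + (y \<bullet> (M *v y)) * t1\<^sup>2) +
      (- t1) * (z \<bullet> (M *v z) + 2 * (z \<bullet> (M *v y)) * t2 + (y \<bullet> (M *v y)) * t2\<^sup>2)"
    by (rule add_pos_pos[OF mult_pos_pos mult_pos_pos]) (use M t in simp_all)
  also have "\<dots> = (t2 - t1) * (z \<bullet> (M *v z) - (t1 * t2) * (y \<bullet> (M *v y)))"
    by (simp add: power2_eq_square algebra_simps)
  finally have "0 < z \<bullet> (M *v z) - (t1 * t2) * (y \<bullet> (M *v y))"
    using t by (simp add: zero_less_mult_iff)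
  then have "- c / a * (y \<bullet> (M *v y)) < z \<bullet> (M *v z)" by (simp add: prod)
  then show ?thesis using a c unfolding a_def c_def by (simp add: field_simps)
qed

text \<open>Dividing by the form of \<open>Q\<close> makes the claim a lower bound on \<alpha> where
  that form is negative and an upper bound where it is positive. The ratio inequality keeps the two
  kinds of bound apart, and compactness makes the largest lower bound an attained maximum.\<close>

lemma S_lemma_nonstrict:
  assumes sym: "symmetric_matrix M" "symmetric_matrix Q" and V: "subspace V"
    and pos: "\<And>y. y \<in> V \<Longrightarrow> y \<noteq> 0 \<Longrightarrow> 0 \<le> y \<bullet> (Q *v y) \<Longrightarrow> 0 < y \<bullet> (M *v y)"
  shows "\<exists>\<alpha>\<ge>0. \<forall>y\<in>V. \<alpha> * (y \<bullet> (Q *v y)) \<le> y \<bullet> (M *v y)"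
proof -
  \<comment> \<open>Only unit vectors at which the form of \<open>M\<close> is nonpositive give a
    lower bound that \<alpha> \<ge> 0 does not already meet; there the form of \<open>Q\<close> is
    negative.\<close>
  define C where "C = {y \<in> V \<inter> sphere 0 1. y \<bullet> (M *v y) \<le> 0}"
  have C_eq: "C = (V \<inter> {y. y \<bullet> (M *v y) \<le> 0}) \<inter> sphere 0 1" by (auto simp: C_def)
  have "compact C"
    unfolding C_eq
    by (intro closed_Int_compact closed_Int closed_subspace V closed_Collect_le
        continuous_on_quadratic_form continuous_on_const compact_sphere)
  have QC: "y \<bullet> (Q *v y) < 0" if "y \<in> C" for y
    using that pos[of y] by (force simp: C_def)
  let ?f = "\<lambda>y. (y \<bullet> (M *v y)) / (y \<bullet> (Q *v y))"
  have "continuous_on C ?f"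
    using QC by (intro continuous_on_divide continuous_on_quadratic_form) force
  obtain \<alpha> where \<alpha>: "\<alpha> \<ge> 0" "\<And>y. y \<in> C \<Longrightarrow> ?f y \<le> \<alpha>"
    "\<And>z. z \<in> V \<Longrightarrow> z \<bullet> (Q *v z) > 0 \<Longrightarrow> \<alpha> \<le> ?f z"
  proof (cases "C = {}")
    case True
    show ?thesis
    proof (rule that[of 0])
      fix z assume "z \<in> V" "z \<bullet> (Q *v z) > 0"
      then show "0 \<le> ?f z" using pos[of z] by (cases "z = 0") (auto simp: less_imp_le)
    qed (use True in auto)
  next
    case False
    then obtain y0 where y0: "y0 \<in> C" "\<And>y. y \<in> C \<Longrightarrow> ?f y \<le> ?f y0"
      using continuous_attains_sup[OF \<open>compact C\<close> _ \<open>continuous_on C ?f\<close>] by blast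
    show ?thesis
    proof (rule that[of "?f y0"])
      show "0 \<le> ?f y0" using y0 QC[of y0] by (simp add: C_def divide_nonpos_neg)
      show "?f y0 \<le> ?f z" if "z \<in> V" "z \<bullet> (Q *v z) > 0" for z
        using quadratic_form_ratio_less[OF sym V pos _ QC[OF y0(1)] that] y0(1)
        by (auto simp: C_def intro: less_imp_le)
    qed (use y0 in auto)
  qed
  have unit: "\<alpha> * (y \<bullet> (Q *v y)) \<le> y \<bullet> (M *v y)" if y: "y \<in> V" "norm y = 1" for y
  proof (cases "y \<in> C")
    case True
    then show ?thesis using \<alpha>(2)[OF True] QC[OF True] by (simp add: field_simps)
  next
    case False
    then have M: "y \<bullet> (M *v y) > 0" using y by (auto simp: C_def)
    show ?thesis
    proof (cases "y \<bullet> (Q *v y) > 0")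
      case True
      then show ?thesis using \<alpha>(3)[OF y(1) True] by (simp add: field_simps)
    next
      case False
      then have "\<alpha> * (y \<bullet> (Q *v y)) \<le> 0" using \<alpha>(1) by (simp add: mult_nonneg_nonpos)
      then show ?thesis using M by linarith
    qed
  qed
  have "\<alpha> * (y \<bullet> (Q *v y)) \<le> y \<bullet> (M *v y)" if y: "y \<in> V" for y
  proof (cases "y = 0")
    case False
    define e where "e = (1 / norm y) *\<^sub>R y"
    have "e \<in> V" "norm e = 1" using y False V by (auto simp: e_def subspace_scale)
    then have "(norm y)\<^sup>2 * (\<alpha> * (e \<bullet> (Q *v e))) \<le> (norm y)\<^sup>2 * (e \<bullet> (M *v e))"
      by (intro mult_left_mono unit) auto
    moreover have "y = norm y *\<^sub>R e" using False by (simp add: e_def)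
    ultimately show ?thesis by (metis quadratic_form_scaleR mult.left_commute)
  qed simp
  then show ?thesis using \<alpha>(1) by blast
qed

text \<open>On the compact set of unit vectors with nonnegative \<open>Q\<close>-form, the form of
  \<open>M\<close> has a positive minimum. Half of it can be subtracted as a multiple of the
  identity without losing the hypothesis, so the nonstrict version applies to the
  difference.\<close>

lemma S_lemma_strict:
  assumes sym: "symmetric_matrix M" "symmetric_matrix Q" and V: "subspace V"
    and pos: "\<And>y. y \<in> V \<Longrightarrow> y \<noteq> 0 \<Longrightarrow> 0 \<le> y \<bullet> (Q *v y) \<Longrightarrow> 0 < y \<bullet> (M *v y)"
  shows "\<exists>\<alpha>\<ge>0. \<exists>\<beta>>0. \<forall>y\<in>V. \<beta> * (y \<bullet> y) + \<alpha> * (y \<bullet> (Q *v y)) \<le> y \<bullet> (M *v y)"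
proof -
  define C where "C = {y \<in> V \<inter> sphere 0 1. 0 \<le> y \<bullet> (Q *v y)}"
  have C_eq: "C = (V \<inter> {y. 0 \<le> y \<bullet> (Q *v y)}) \<inter> sphere 0 1" by (auto simp: C_def)
  have "compact C"
    unfolding C_eq
    by (intro closed_Int_compact closed_Int closed_subspace V closed_Collect_le
        continuous_on_quadratic_form continuous_on_const compact_sphere)
  have MC: "0 < y \<bullet> (M *v y)" if "y \<in> C" for y
    using that pos[of y] by (force simp: C_def)
  obtain \<beta> where \<beta>: "\<beta> > 0" "\<And>y. y \<in> C \<Longrightarrow> \<beta> < y \<bullet> (M *v y)"
  proof (cases "C = {}")
    case True
    \<comment> \<open>With no such unit vector every positive \<beta> serves.\<close>
    then show ?thesis by (intro that[of 1]) auto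
  next
    case False
    then obtain y0 where y0: "y0 \<in> C" "\<And>y. y \<in> C \<Longrightarrow> y0 \<bullet> (M *v y0) \<le> y \<bullet> (M *v y)"
      using continuous_attains_inf[OF \<open>compact C\<close> _ continuous_on_quadratic_form] by blast
    show ?thesis
      by (rule that[of "(y0 \<bullet> (M *v y0)) / 2"]) (use y0 MC in force)+
  qed
  define M' where "M' = M - \<beta> *\<^sub>R mat 1"
  have M': "y \<bullet> (M' *v y) = y \<bullet> (M *v y) - \<beta> * (y \<bullet> y)" for y
    by (simp add: M'_def matrix_vector_mult_diff_rdistrib inner_diff_right scaleR_matrix_vector_assoc[symmetric])
  have "symmetric_matrix M'"
    using sym(1) by (simp add: M'_def symmetric_matrix_def transpose_def vec_eq_iff mat_def)
  moreover have "0 < y \<bullet> (M' *v y)" if y: "y \<in> V" "y \<noteq> 0" "0 \<le> y \<bullet> (Q *v y)" for y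
  proof -
    define e where "e = (1 / norm y) *\<^sub>R y"
    have "0 \<le> e \<bullet> (Q *v e)" unfolding e_def quadratic_form_scaleR using y by simp
    then have "e \<in> C" using y V by (auto simp: e_def C_def subspace_scale)
    then have "0 < (norm y)\<^sup>2 * (e \<bullet> (M *v e) - \<beta>)" using \<beta>(2) y by simp
    moreover have "e \<bullet> e = 1" using \<open>e \<in> C\<close> by (simp add: C_def dot_square_norm)
    ultimately have "0 < (norm y)\<^sup>2 * (e \<bullet> (M' *v e))" by (simp add: M')
    moreover have "y = norm y *\<^sub>R e" using y by (simp add: e_def)
    ultimately show ?thesis by (metis quadratic_form_scaleR)
  qed
  ultimately obtain \<alpha> where "\<alpha> \<ge> 0" "\<forall>y\<in>V. \<alpha> * (y \<bullet> (Q *v y)) \<le> y \<bullet> (M' *v y)"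
    using S_lemma_nonstrict[OF _ sym(2) V, of M'] by blast
  then show ?thesis using \<beta>(1) by (intro exI[of _ \<alpha>] conjI exI[of _ \<beta>]) (auto simp: M' algebra_simps)
qed

section \<open>Partitioned vectors\<close>

definition vec_pair :: "real^'p \<Rightarrow> real^'q \<Rightarrow> real^('p + 'q)" where
  "vec_pair v w = (\<chi> i. case i of Inl a \<Rightarrow> v $ a | Inr b \<Rightarrow> w $ b)"

lemma sum_UNIV_sum_type:
  fixes f :: "'p::finite + 'q::finite \<Rightarrow> 'c::comm_monoid_add"
  shows "(\<Sum>i\<in>UNIV. f i) = (\<Sum>a\<in>UNIV. f (Inl a)) + (\<Sum>b\<in>UNIV. f (Inr b))"
  unfolding UNIV_Plus_UNIV[symmetric] by (subst sum.Plus) auto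

lemma vec_pair_cases:
  obtains v w where "y = vec_pair v w"
proof
  show "y = vec_pair (\<chi> a. y $ Inl a) (\<chi> b. y $ Inr b)"
    by (simp add: vec_pair_def vec_eq_iff split: sum.split)
qed

lemma vec_pair_0: "vec_pair 0 0 = 0"
  by (simp add: vec_pair_def vec_eq_iff split: sum.split)

lemma vec_pair_add: "vec_pair v w + vec_pair v' w' = vec_pair (v + v') (w + w')"
  by (simp add: vec_pair_def vec_eq_iff split: sum.split)

lemma vec_pair_scaleR: "c *\<^sub>R vec_pair v w = vec_pair (c *\<^sub>R v) (c *\<^sub>R w)"
  by (simp add: vec_pair_def vec_eq_iff split: sum.split)

lemma inner_vec_pair: "vec_pair v w \<bullet> vec_pair v' w' = v \<bullet> v' + w \<bullet> w'"
  by (simp add: inner_vec_def sum_UNIV_sum_type vec_pair_def)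

lemma matrix_mult_vec_pair:
  "P *v vec_pair v w =
    vec_pair (block11 P *v v + block12 P *v w) (block21 P *v v + block22 P *v w)"
  by (simp add: vec_eq_iff matrix_vector_mult_def sum_UNIV_sum_type vec_pair_def block11_def
      block12_def block21_def block22_def split: sum.split)

lemma vstack_mult_vec: "vstack A B *v v = vec_pair (A *v v) (B *v v)"
  by (simp add: vec_eq_iff matrix_vector_mult_def vec_pair_def vstack_def split: sum.split)

lemma symmetric_matrix_blocks:
  assumes "symmetric_matrix P"
  shows "symmetric_matrix (block11 P)" "symmetric_matrix (block22 P)"
    "block21 P = transpose (block12 P)"
  using assms
  by (simp_all add: symmetric_matrix_def transpose_def vec_eq_iff block11_def block22_def
      block12_def block21_def)

lemma inner_transpose: "v \<bullet> (A *v w) = (transpose A *v v) \<bullet> w" for A :: "real^'n^'m"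
  by (metis dot_lmul_matrix transpose_matrix_vector)

section \<open>Congruences, null vectors and the S-lemma for partitioned matrices\<close>

lemma symmetric_matrix_null_pair:
  assumes "symmetric_matrix P" and "block22 P *v w = 0" and "block12 P *v w = 0"
  shows "P *v vec_pair 0 w = 0"
  using assms by (simp add: matrix_mult_vec_pair vec_pair_0)

lemma symmetric_congruence:
  assumes "symmetric_matrix P"
  shows "symmetric_matrix (transpose S ** P ** S)"
  using assms by (simp add: symmetric_matrix_def matrix_transpose_mul matrix_mul_assoc)

lemma inner_congruence: "v \<bullet> ((transpose S ** P ** S) *v w) = (S *v v) \<bullet> (P *v (S *v w))"
  for S :: "real^'n^'m"
  by (simp only: matrix_vector_mul_assoc[symmetric] inner_transpose[of v] transpose_transpose)

text \<open>
  On the null directions \<open>k = (0, w)\<close> of \<open>Q\<close> also \<open>M\<close> vanishes: the form of \<open>M\<close> stays positive along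
  the line \<open>y + t k\<close>, but it is concave in \<open>t\<close>.
\<close>

lemma matrix_S_lemma:
  fixes M Q :: "real^('n::finite + 'k::finite)^('n + 'k)"
  assumes sym: "symmetric_matrix M" "symmetric_matrix Q"
    and M22: "block22 M \<preceq> 0" and Q22: "block22 Q \<preceq> 0"
    and ker: "{w. block22 Q *v w = 0} \<subseteq> {w. block12 Q *v w = 0}"
    and feasible: "\<And>v. \<exists>w. 0 \<le> vec_pair v w \<bullet> (Q *v vec_pair v w)"
    and pos: "\<And>v w. v \<noteq> 0 \<Longrightarrow> 0 \<le> vec_pair v w \<bullet> (Q *v vec_pair v w) \<Longrightarrow>
      0 < vec_pair v w \<bullet> (M *v vec_pair v w)"
  shows "\<exists>\<alpha>\<ge>0. \<exists>\<beta>>0. block_matrix (\<beta> *\<^sub>R mat 1) 0 0 0 \<preceq> M - \<alpha> *\<^sub>R Q"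
proof -
  define K :: "(real^('n + 'k)) set" where "K = {vec_pair 0 w | w. block22 Q *v w = 0}"
  have "subspace K"
    unfolding subspace_def
  proof (intro conjI ballI allI)
    show "0 \<in> K" unfolding K_def using vec_pair_0[symmetric] by force
  next
    fix a b assume "a \<in> K" "b \<in> K"
    then show "a + b \<in> K"
      by (force simp: K_def vec_pair_add matrix_vector_right_distrib)
  next
    fix c :: real and a assume "a \<in> K"
    then show "c *\<^sub>R a \<in> K" by (force simp: K_def vec_pair_scaleR matrix_vector_mult_scaleR)
  qed
  have QK: "Q *v k = 0" if "k \<in> K" for k
    using that ker symmetric_matrix_null_pair[OF sym(2)] by (force simp: K_def)
  have MK: "M *v k = 0" if "k \<in> K" for k
  proof -
    from that obtain w where k: "k = vec_pair 0 w" and w: "block22 Q *v w = 0"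
      by (auto simp: K_def)
    have kk: "k \<bullet> (M *v k) = w \<bullet> (block22 M *v w)"
      by (simp add: k matrix_mult_vec_pair inner_vec_pair)
    have *: "w \<bullet> (block22 M *v w) = 0 \<and> vec_pair v w0 \<bullet> (M *v k) = 0"
      if "v \<noteq> 0" "0 \<le> vec_pair v w0 \<bullet> (Q *v vec_pair v w0)" for v w0
    proof -
      have "0 < vec_pair v w0 \<bullet> (M *v vec_pair v w0) + 2 * (vec_pair v w0 \<bullet> (M *v k)) * t +
          (w \<bullet> (block22 M *v w)) * t\<^sup>2" for t
      proof -
        have e: "vec_pair v w0 + t *\<^sub>R k = vec_pair v (w0 + t *\<^sub>R w)"
          by (simp add: k vec_pair_scaleR vec_pair_add)
        have "0 < (vec_pair v w0 + t *\<^sub>R k) \<bullet> (M *v (vec_pair v w0 + t *\<^sub>R k))"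
          unfolding e
        proof (rule pos[OF \<open>v \<noteq> 0\<close>])
          show "0 \<le> vec_pair v (w0 + t *\<^sub>R w) \<bullet> (Q *v vec_pair v (w0 + t *\<^sub>R w))"
            unfolding e[symmetric] quadratic_form_add_scaleR[OF sym(2)]
            using QK[OF \<open>k \<in> K\<close>] that by simp
        qed
        then show ?thesis by (simp only: quadratic_form_add_scaleR[OF sym(1)] kk)
      qed
      from quadratic_pos_imp[OF this loewner_le_zeroD(2)[OF M22]] show ?thesis by simp
    qed
    have "block22 M *v w = 0"
    proof -
      obtain v :: "real^'n" where "v \<noteq> 0" by (metis axis_eq_0_iff zero_neq_one)
      then show ?thesis using * feasible loewner_le_zeroD(3)[OF M22] by metis
    qed
    moreover have "block12 M *v w = 0"
    proof (rule ccontr)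
      assume ne: "block12 M *v w \<noteq> 0"
      \<comment> \<open>The upper component is chosen as \<open>block12 M *v w\<close> itself: since
        \<open>block22 M *v w = 0\<close>, the pairing with \<open>M *v k\<close> is then the
        squared norm of that vector.\<close>
      obtain w0 where "vec_pair (block12 M *v w) w0 \<bullet> (M *v k) = 0"
        using * ne feasible by metis
      then show False
        using ne \<open>block22 M *v w = 0\<close> by (simp add: k matrix_mult_vec_pair inner_vec_pair)
    qed
    ultimately show ?thesis unfolding k by (intro symmetric_matrix_null_pair sym)
  qed
  define V where "V = orthogonal_comp K"
  have "subspace V" by (simp add: V_def subspace_orthogonal_comp)
  \<comment> \<open>On \<open>V\<close> the restriction to nonzero upper components disappears: a
    vector \<open>(0, w)\<close> with nonnegative \<open>Q\<close>-form lies in \<open>K\<close>,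
    hence is zero if it also lies in \<open>V\<close>.\<close>
  have "0 < y \<bullet> (M *v y)" if y: "y \<in> V" "y \<noteq> 0" "0 \<le> y \<bullet> (Q *v y)" for y
  proof -
    obtain v w where vw: "y = vec_pair v w" by (rule vec_pair_cases)
    have "v \<noteq> 0"
    proof
      assume "v = 0"
      then have "w \<bullet> (block22 Q *v w) = 0"
        using y(3) loewner_le_zeroD(2)[OF Q22, of w]
        by (simp add: vw matrix_mult_vec_pair inner_vec_pair)
      then have "y \<in> K" using loewner_le_zeroD(3)[OF Q22] \<open>v = 0\<close> by (auto simp: K_def vw)
      then show False using y by (auto simp: V_def orthogonal_comp_def orthogonal_def)
    qed
    then show ?thesis using pos y(3) by (simp add: vw)
  qed
  then obtain \<alpha> \<beta> where \<alpha>\<beta>: "\<alpha> \<ge> 0" "\<beta> > 0"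
    "\<And>y. y \<in> V \<Longrightarrow> \<beta> * (y \<bullet> y) + \<alpha> * (y \<bullet> (Q *v y)) \<le> y \<bullet> (M *v y)"
    using S_lemma_strict[OF sym \<open>subspace V\<close>] by blast
  let ?B = "block_matrix (\<beta> *\<^sub>R mat 1) 0 0 0 :: real^('n + 'k)^('n + 'k)"
  \<comment> \<open>Split \<open>y\<close> into \<open>k\<close> in \<open>K\<close> and
    \<open>z\<close> in \<open>V\<close>. The forms of \<open>M\<close> and \<open>Q\<close> see
    only \<open>z\<close>, and so does \<open>?B\<close>, because \<open>k\<close> has no upper
    component.\<close>
  have "0 \<le> y \<bullet> ((M - \<alpha> *\<^sub>R Q - ?B) *v y)" for y
  proof -
    obtain k z where k: "k \<in> span K" and z: "\<And>w. w \<in> span K \<Longrightarrow> orthogonal z w"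
      and y: "y = k + z"
      using orthogonal_subspace_decomp_exists[of K y] by blast
    have kK: "k \<in> K" using k span_eq_iff[THEN iffD2, OF \<open>subspace K\<close>] by simp
    have zV: "z \<in> V"
      unfolding V_def orthogonal_comp_def using z span_base by (auto simp: orthogonal_def inner_commute)
    have drop: "y \<bullet> (P *v y) = z \<bullet> (P *v z)" if "symmetric_matrix P" "P *v k = 0" for P
      using quadratic_form_add_scaleR[OF that(1), of z 1 k] that(2)
      unfolding y add.commute[of k z] by simp
    obtain v w where vw: "z = vec_pair v w" by (rule vec_pair_cases)
    obtain w' where w': "k = vec_pair 0 w'" using kK by (auto simp: K_def)
    have B: "y \<bullet> (?B *v y) = \<beta> * (v \<bullet> v)"
      by (simp add: y vw w' vec_pair_add matrix_mult_vec_pair inner_vec_pair block_matrix_inverse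
          scaleR_matrix_vector_assoc[symmetric])
    have "\<beta> * (v \<bullet> v) \<le> \<beta> * (z \<bullet> z)" using \<alpha>\<beta>(2) by (simp add: vw inner_vec_pair)
    then show ?thesis
      using \<alpha>\<beta>(3)[OF zV] drop[OF sym(1) MK[OF kK]] drop[OF sym(2) QK[OF kK]]
      by (simp add: matrix_vector_mult_diff_rdistrib inner_diff_right B
          scaleR_matrix_vector_assoc[symmetric])
  qed
  moreover have "symmetric_matrix (M - \<alpha> *\<^sub>R Q - ?B)"
    using sym
    by (simp add: symmetric_matrix_def transpose_def vec_eq_iff block_matrix_def mat_def
        split: sum.split)
  ultimately show ?thesis using \<alpha>\<beta>(1,2) by (auto simp: loewner_le_def pos_semidef_def)
qed

lemma symmetric_block_matrix:
  fixes B :: "real^'q::finite^'p::finite"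
  assumes "symmetric_matrix A" and "symmetric_matrix D"
  shows "symmetric_matrix (block_matrix A B (transpose B) D)"
  using assms
  by (simp add: symmetric_matrix_def transpose_def block_matrix_def vec_eq_iff split: sum.split)

section \<open>Vectorization\<close>

lemma inner_vectorize: "vectorize A \<bullet> vectorize B = A \<bullet> B" for A B :: "real^'c^'r"
proof -
  have "A \<bullet> B = (\<Sum>j\<in>UNIV. \<Sum>i\<in>UNIV. A $ i $ j * B $ i $ j)"
    unfolding inner_vec_def inner_real_def by (rule sum.swap)
  also have "\<dots> = (\<Sum>(j, i)\<in>UNIV. A $ i $ j * B $ i $ j)"
    unfolding UNIV_Times_UNIV[symmetric] by (rule sum.cartesian_product)
  finally show ?thesis
    unfolding inner_vec_def[of "vectorize A"] by (simp add: vectorize_def case_prod_beta)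
qed

lemma kronecker_mult_vectorize:
  fixes K :: "real^'b^'a" and A :: "real^'b^'c"
  shows "(K \<otimes>\<^sub>K mat 1) *v vectorize A = vectorize (A ** transpose K)"
proof -
  have "((K \<otimes>\<^sub>K (mat 1 :: real^'c^'c)) *v vectorize A) $ p = vectorize (A ** transpose K) $ p" for p
  proof -
    have "((K \<otimes>\<^sub>K (mat 1 :: real^'c^'c)) *v vectorize A) $ p =
        (\<Sum>q\<in>UNIV. K $ fst p $ fst q * (mat 1 :: real^'c^'c) $ snd p $ snd q * A $ snd q $ fst q)"
      by (simp add: matrix_vector_mult_def kronecker_def vectorize_def)
    also have "\<dots> = (\<Sum>b\<in>UNIV. \<Sum>d\<in>UNIV. K $ fst p $ b * (mat 1 :: real^'c^'c) $ snd p $ d * A $ d $ b)"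
      by (simp add: sum.cartesian_product UNIV_Times_UNIV[symmetric] case_prod_beta
          del: UNIV_Times_UNIV)
    also have "\<dots> = (\<Sum>b\<in>UNIV. \<Sum>d\<in>UNIV. if snd p = d then K $ fst p $ b * A $ d $ b else 0)"
      by (intro sum.cong refl) (simp add: mat_def)
    also have "\<dots> = vectorize (A ** transpose K) $ p"
      by (simp add: vectorize_def matrix_matrix_mult_def transpose_def mult.commute)
    finally show ?thesis .
  qed
  then show ?thesis by (simp add: vec_eq_iff)
qed

lemma columnvector_mult: "columnvector g *v (c :: real^1) = c $ 1 *\<^sub>R g"
  by (simp add: columnvector_def matrix_vector_mult_def vec_eq_iff sum_1 mult.commute)

lemma columnvector_mult_1: "columnvector g *v (1 :: real^1) = g"
  by (simp add: columnvector_mult)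

lemma vectorize_diff: "vectorize (A - B) = vectorize A - vectorize B"
  by (simp add: vectorize_def vec_eq_iff)

lemma inner_1_mult_1: "1 \<bullet> (S *v 1) = S $ 1 $ 1" for S :: "real^1^1"
  by (simp add: inner_vec_def matrix_vector_mult_def sum_1)

text \<open>Turns the membership condition of \<open>noise_set\<close>, stated with a 1 x 1 matrix,
  into a scalar inequality.\<close>

lemma loewner_le_1_iff: "0 \<preceq> (S :: real^1^1) \<longleftrightarrow> 0 \<le> 1 \<bullet> (S *v 1)"
proof -
  have form: "y \<bullet> (S *v y) = (y $ 1)\<^sup>2 * S $ 1 $ 1" for y
    by (simp add: inner_vec_def matrix_vector_mult_def sum_1 power2_eq_square)
  have "symmetric_matrix S"
    by (simp add: symmetric_matrix_def transpose_def vec_eq_iff forall_1)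
  moreover have "(\<forall>y :: real^1. 0 \<le> (y $ 1)\<^sup>2 * S $ 1 $ 1) \<longleftrightarrow> 0 \<le> S $ 1 $ 1" (is "?L \<longleftrightarrow> _")
  proof
    assume ?L
    from this[rule_format, of "1 :: real^1"] show "0 \<le> S $ 1 $ 1" by simp
  qed simp
  ultimately show ?thesis
    by (simp add: loewner_le_def pos_semidef_def form)
qed

section \<open>Rank-one matrices and traces of quadratic forms\<close>

definition outer_product :: "real^'p \<Rightarrow> real^'q \<Rightarrow> real^'q^'p" where
  "outer_product a w = (\<chi> i j. a $ i * w $ j)"

lemma outer_product_row: "outer_product a w $ i = a $ i *\<^sub>R w"
  by (simp add: outer_product_def vec_eq_iff)

lemma transpose_outer_product_mult: "transpose (outer_product a w) *v v = (a \<bullet> v) *\<^sub>R w"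
proof -
  have "(transpose (outer_product a w) *v v) $ j = ((a \<bullet> v) *\<^sub>R w) $ j" for j
    unfolding outer_product_def transpose_def matrix_vector_mult_def inner_vec_def
    by (simp add: sum_distrib_left mult.commute mult.left_commute)
  then show ?thesis by (simp add: vec_eq_iff)
qed

lemma matrix_mult_row: "(D ** R) $ i = transpose R *v D $ i" for R :: "real^'m^'n"
  by (auto simp: vec_eq_iff matrix_matrix_mult_def matrix_vector_mult_def transpose_def
      intro!: sum.cong)

lemma inner_matrix_mult_left: "(A ** B) \<bullet> C = A \<bullet> (C ** transpose B)"
  for A :: "real^'n^'m"
proof -
  have "(A ** B) $ i \<bullet> C $ i = A $ i \<bullet> (C ** transpose B) $ i" for i
    unfolding matrix_mult_row transpose_transpose by (rule inner_transpose[symmetric])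
  then show ?thesis by (simp only: inner_vec_def[where 'b = 'm])
qed

text \<open>The inner product on matrices is the Frobenius one, so the left side is the trace of
  \<open>D ** R ** transpose D\<close>. Its sum over rows inherits the sign of the form of
  \<open>R\<close>.\<close>

lemma inner_matrix_mult:
  assumes "symmetric_matrix R"
  shows "D \<bullet> (D ** R) = (\<Sum>i\<in>UNIV. D $ i \<bullet> (R *v D $ i))"
  using assms by (simp add: inner_vec_def[of D] matrix_mult_row symmetric_matrix_def)

lemma inner_matrix_mult_outer_product:
  assumes "symmetric_matrix R"
  shows "outer_product a w \<bullet> (outer_product a w ** R) = (a \<bullet> a) * (w \<bullet> (R *v w))"
  unfolding inner_matrix_mult[OF assms] outer_product_row quadratic_form_scaleR
  by (simp add: inner_vec_def[of a] sum_distrib_right power2_eq_square)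

text \<open>
  Lagrange's identity: twice the left side minus the right side is the sum of the form of \<open>R\<close> over the
  vectors \<open>v $ i *\<^sub>R D $ j - v $ j *\<^sub>R D $ i\<close>.
\<close>

lemma frobenius_le_quadratic_form:
  fixes D :: "real^'k^'n"
  assumes "R \<preceq> 0"
  shows "(v \<bullet> v) * (D \<bullet> (D ** R)) \<le> (transpose D *v v) \<bullet> (R *v (transpose D *v v))"
proof -
  note sym = loewner_le_zeroD(1)[OF assms]
  define b where "b i j = D $ i \<bullet> (R *v D $ j)" for i j
  have d: "transpose D *v v = (\<Sum>i\<in>UNIV. v $ i *\<^sub>R D $ i)"
    by (simp add: vec_eq_iff matrix_vector_mult_def transpose_def mult.commute)
  have "R *v (\<Sum>i\<in>UNIV. v $ i *\<^sub>R D $ i) = (\<Sum>i\<in>UNIV. v $ i *\<^sub>R (R *v D $ i))"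
    by (simp add: linear_sum[OF matrix_vector_mul_linear] matrix_vector_mult_scaleR)
  then have "(transpose D *v v) \<bullet> (R *v (transpose D *v v)) =
      (\<Sum>i\<in>UNIV. \<Sum>j\<in>UNIV. v $ j * v $ i * b j i)"
    unfolding d by (simp add: inner_sum_left inner_sum_right b_def sum_distrib_left ac_simps)
  also have "\<dots> = (\<Sum>i\<in>UNIV. \<Sum>j\<in>UNIV. v $ i * v $ j * b i j)" by (rule sum.swap)
  finally have quad: "(transpose D *v v) \<bullet> (R *v (transpose D *v v)) =
      (\<Sum>i\<in>UNIV. \<Sum>j\<in>UNIV. v $ i * v $ j * b i j)" .
  have trace: "(v \<bullet> v) * (D \<bullet> (D ** R)) = (\<Sum>i\<in>UNIV. \<Sum>j\<in>UNIV. v $ i * v $ i * b j j)"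
    by (simp add: inner_matrix_mult[OF sym] b_def inner_vec_def[of v] sum_product)
  \<comment> \<open>The trace term is kept in both index orders; together they supply the two square
    terms of the summand below.\<close>
  also have trace': "\<dots> = (\<Sum>i\<in>UNIV. \<Sum>j\<in>UNIV. v $ j * v $ j * b i i)"
    by (rule sum.swap)
  have "v $ i * v $ i * b j j + v $ j * v $ j * b i i - 2 * (v $ i * v $ j * b i j) \<le> 0" for i j
    using loewner_le_zeroD(2)[OF assms, of "v $ i *\<^sub>R D $ j - v $ j *\<^sub>R D $ i"]
      symmetric_inner_commute[OF sym, of "D $ i" "D $ j"]
    by (simp add: b_def matrix_vector_mult_diff_distrib matrix_vector_mult_scaleR
        inner_diff_left inner_diff_right algebra_simps)
  then have "(\<Sum>i\<in>UNIV. \<Sum>j\<in>UNIV.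
      v $ i * v $ i * b j j + v $ j * v $ j * b i i - 2 * (v $ i * v $ j * b i j)) \<le> 0"
    by (intro sum_nonpos)
  then show ?thesis
    unfolding quad
    using trace trace' by (simp add: sum.distrib sum_subtractf sum_distrib_left[symmetric])
qed

section \<open>Pseudoinverses\<close>

lemma pseudoinverse_mult: "A ** pseudoinverse A ** A = A"
  using is_pseudoinverse_pseudoinverse[of A] by (simp add: is_pseudoinverse_def)

text \<open>Transposing the four Penrose equations of a symmetric matrix shows that the transposed
  pseudoinverse satisfies them as well; uniqueness does the rest.\<close>

lemma symmetric_pseudoinverse:
  assumes "symmetric_matrix A"
  shows "symmetric_matrix (pseudoinverse A)"
proof -
  let ?Z = "pseudoinverse A"
  have A: "transpose A = A" using assms by (simp add: symmetric_matrix_def)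
  have Z: "A ** ?Z ** A = A" "?Z ** A ** ?Z = ?Z"
    "transpose (A ** ?Z) = A ** ?Z" "transpose (?Z ** A) = ?Z ** A"
    using is_pseudoinverse_pseudoinverse[of A] by (simp_all add: is_pseudoinverse_def)
  have "A ** transpose ?Z ** A = A"
    using arg_cong[OF Z(1), of transpose] by (simp add: matrix_transpose_mul A matrix_mul_assoc)
  moreover have "transpose ?Z ** A ** transpose ?Z = transpose ?Z"
    using arg_cong[OF Z(2), of transpose] by (simp add: matrix_transpose_mul A matrix_mul_assoc)
  moreover have "transpose (A ** transpose ?Z) = A ** transpose ?Z"
    using Z(4) by (simp add: matrix_transpose_mul A)
  moreover have "transpose (transpose ?Z ** A) = transpose ?Z ** A"
    using Z(3) by (simp add: matrix_transpose_mul A)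
  ultimately have "is_pseudoinverse A (transpose ?Z)" by (simp add: is_pseudoinverse_def)
  then show ?thesis
    unfolding symmetric_matrix_def
    using is_pseudoinverse_unique is_pseudoinverse_pseudoinverse by blast
qed

text \<open>The vector \<open>pseudoinverse R *v (R *v w) - w\<close> lies in the kernel of
  \<open>R\<close>, hence in that of \<open>L\<close>. This makes \<open>L\<close> factor through
  \<open>R\<close>, as completing the square requires.\<close>

lemma mult_pseudoinverse_mult:
  assumes "{w. R *v w = 0} \<subseteq> {w. L *v w = 0}"
  shows "L ** pseudoinverse R ** R = L"
proof (rule iffD2[OF matrix_eq], rule allI)
  fix w
  have "R *v (pseudoinverse R *v (R *v w)) = R *v w"
    using pseudoinverse_mult[of R] by (simp add: matrix_vector_mul_assoc matrix_mul_assoc)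
  then have "R *v (pseudoinverse R *v (R *v w) - w) = 0"
    by (simp add: matrix_vector_mult_diff_distrib)
  then have "L *v (pseudoinverse R *v (R *v w) - w) = 0" using assms by blast
  then show "L ** pseudoinverse R ** R *v w = L *v w"
    by (simp add: matrix_vector_mult_diff_distrib matrix_vector_mul_assoc matrix_mul_assoc)
qed

section \<open>Completing the square\<close>

lemma matrix_mult_add_rdistrib: "(A + B) ** C = A ** C + B ** C"
  by (simp add: vec_eq_iff matrix_matrix_mult_def sum.distrib distrib_right)

text \<open>Since \<open>L = H ** R\<close>, the cross terms pair \<open>w\<close> with
  \<open>transpose H *v v\<close> under \<open>R\<close>, and \<open>L ** transpose H\<close> is the
  missing square \<open>H ** R ** transpose H\<close>.\<close>

lemma square_completion_vec:
  assumes R: "symmetric_matrix R" and HR: "H ** R = L"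
  shows "vec_pair v w \<bullet>
      (block_matrix (s *\<^sub>R mat 1 + L ** transpose H) L (transpose L) R *v vec_pair v w) =
    s * (v \<bullet> v) + (w + transpose H *v v) \<bullet> (R *v (w + transpose H *v v))"
proof -
  have LT: "transpose L *v v = R *v (transpose H *v v)"
    using R HR by (metis matrix_transpose_mul matrix_vector_mul_assoc symmetric_matrix_def)
  have 1: "v \<bullet> (L *v y) = y \<bullet> (R *v (transpose H *v v))" for y
    unfolding LT[symmetric] inner_transpose[of v L y] by (rule inner_commute)
  show ?thesis
    unfolding matrix_mult_vec_pair inner_vec_pair block_matrix_inverse
      matrix_vector_mult_add_rdistrib matrix_vector_right_distrib matrix_vector_mul_assoc[symmetric]
      scaleR_matrix_vector_assoc[symmetric] LT inner_add_left inner_add_right 1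
    using symmetric_inner_commute[OF R, of w "transpose H *v v"]
    by simp
qed

text \<open>The same shift \<open>H\<close> completes the square for the vectorized unknown, because
  \<open>block22 N\<close> acts on \<open>vectorize Y\<close> as right multiplication of
  \<open>Y\<close> by \<open>R\<close>. The constant left over is the Schur complement.\<close>

lemma square_completion_vectorize:
  fixes N :: "real^(1 + 'k::finite \<times> 'n::finite)^(1 + 'k \<times> 'n)"
  assumes N: "symmetric_matrix N" and N22: "block22 N = R \<otimes>\<^sub>K mat 1"
    and N21: "block21 N = columnvector (vectorize L)"
    and R: "symmetric_matrix R" and HR: "H ** R = L"
  shows "vec_pair 1 (vectorize Z) \<bullet> (N *v vec_pair 1 (vectorize Z)) =
    schur N $ 1 $ 1 + (Z + H) \<bullet> ((Z + H) ** R)"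
proof -
  have N22_mult: "block22 N *v vectorize Y = vectorize (Y ** R)" for Y
    using R by (simp add: N22 kronecker_mult_vectorize symmetric_matrix_def)
  have sym22: "symmetric_matrix (block22 N)" by (rule symmetric_matrix_blocks(2)[OF N])
  have b: "block21 N *v 1 = vectorize L" by (simp add: N21 columnvector_mult_1)
  have b': "1 \<bullet> (block12 N *v y) = vectorize L \<bullet> y" for y
    using b unfolding symmetric_matrix_blocks(3)[OF N] inner_transpose[of 1 "block12 N" y] by simp
  have gH: "block22 N *v vectorize H = vectorize L" by (simp add: N22_mult HR)
  have "1 \<bullet> (schur N *v 1) = 1 \<bullet> (block11 N *v 1) - vectorize L \<bullet> (pseudoinverse (block22 N) *v vectorize L)"
    by (simp add: schur_def matrix_vector_mult_diff_rdistrib inner_diff_right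
        matrix_vector_mul_assoc[symmetric] b b')
  \<comment> \<open>Both copies of \<open>vectorize L\<close> are written as
    \<open>block22 N *v vectorize H\<close>, so that the pseudoinverse cancels.\<close>
  also have "vectorize L \<bullet> (pseudoinverse (block22 N) *v vectorize L) =
      vectorize H \<bullet> (block22 N *v (pseudoinverse (block22 N) *v (block22 N *v vectorize H)))"
    unfolding gH[symmetric]
    by (simp only: inner_transpose[of "vectorize H" "block22 N"] sym22[unfolded symmetric_matrix_def])
  also have "\<dots> = vectorize H \<bullet> vectorize L"
    by (simp only: matrix_vector_mul_assoc matrix_mul_assoc pseudoinverse_mult) (simp only: gH)
  finally have s: "schur N $ 1 $ 1 = 1 \<bullet> (block11 N *v 1) - H \<bullet> L"
    by (simp add: inner_vectorize inner_1_mult_1)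
  have com: "vectorize H \<bullet> vectorize (Z ** R) = vectorize Z \<bullet> vectorize L"
    using symmetric_inner_commute[OF sym22, of "vectorize H" "vectorize Z"]
    by (simp add: N22_mult HR)
  have "(Z + H) \<bullet> ((Z + H) ** R) = Z \<bullet> (Z ** R) + 2 * (Z \<bullet> L) + H \<bullet> L"
    using com by (simp add: matrix_mult_add_rdistrib HR inner_add_left inner_add_right inner_vectorize)
  moreover have "vec_pair 1 (vectorize Z) \<bullet> (N *v vec_pair 1 (vectorize Z)) =
      1 \<bullet> (block11 N *v 1) + 2 * (Z \<bullet> L) + Z \<bullet> (Z ** R)"
    by (simp add: matrix_mult_vec_pair inner_vec_pair inner_add_right b b' N22_mult inner_vectorize
        inner_commute)
  ultimately show ?thesis by (simp add: s)
qed

section \<open>Data-compatible systems\<close>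

text \<open>For \<open>c = 1\<close> the lower part is the noise that the system \<open>Z\<close>
  leaves unexplained; \<open>c = 0\<close> isolates the part linear in \<open>Z\<close>, which
  governs \<open>block22\<close> of \<open>N_matrix\<close>.\<close>

lemma E_matrix_mult:
  fixes u :: "nat \<Rightarrow> real^'m" and x :: "nat \<Rightarrow> real^'n"
  shows "(E_matrix u x :: real^_^(1 + 't::{finite,linorder} \<times> 'n)) *v vec_pair c (vectorize Z) =
    vec_pair c (c $ 1 *\<^sub>R vectorize (future x) - vectorize (Z ** vstack (past x) (past u)))"
  unfolding E_matrix_def matrix_mult_vec_pair block_matrix_inverse uminus_matrix_vector_mult
    kronecker_mult_vectorize columnvector_mult transpose_transpose
  by simp

lemma noise_set_iff:
  "W \<in> noise_set \<Phi> \<longleftrightarrow>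
    0 \<le> vec_pair 1 (vectorize W) \<bullet> (\<Phi> *v vec_pair 1 (vectorize W))"
  unfolding noise_set_def mem_Collect_eq loewner_le_1_iff inner_congruence one_vec_def
  by (simp add: vstack_mult_vec columnvector_mult_1)

lemma system_matrix_mult:
  fixes A :: "real^'n::finite^'n" and B :: "real^'m::finite^'n" and X :: "real^'t^'n" and U :: "real^'t^'m"
  shows "transpose (vstack (transpose A) (transpose B)) ** vstack X U = A ** X + B ** U"
  by (simp add: vec_eq_iff matrix_matrix_mult_def transpose_def vstack_def sum_UNIV_sum_type)

lemma system_matrix_cases:
  fixes Z :: "real^('n::finite + 'm::finite)^'n"
  obtains A :: "real^'n^'n" and B :: "real^'m^'n"
  where "Z = transpose (vstack (transpose A) (transpose B))"
proof
  show "Z = transpose (vstack (transpose (\<chi> i j. Z $ i $ Inl j)) (transpose (\<chi> i j. Z $ i $ Inr j)))"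
    by (simp add: vec_eq_iff transpose_def vstack_def split: sum.split)
qed

text \<open>The data and \<open>(A, B)\<close> determine the noise matrix as a residual, and
  \<open>N_matrix\<close> is the pullback of \<open>\<Phi>\<close> along the map to that
  residual.\<close>

lemma compatible_systems_iff:
  fixes u :: "nat \<Rightarrow> real^'m" and x :: "nat \<Rightarrow> real^'n"
    and \<Phi> :: "real^(1 + 't::{finite,linorder} \<times> 'n)^(1 + 't \<times> 'n)"
  assumes Z: "Z = transpose (vstack (transpose A) (transpose B))"
  shows "(A, B) \<in> compatible_systems u x (noise_set \<Phi>) \<longleftrightarrow>
    0 \<le> vec_pair 1 (vectorize Z) \<bullet> (N_matrix u x \<Phi> *v vec_pair 1 (vectorize Z))"
proof -
  have "(A, B) \<in> compatible_systems u x (noise_set \<Phi>) \<longleftrightarrow>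
      future x - Z ** vstack (past x) (past u) \<in> noise_set \<Phi>"
    unfolding compatible_systems_def Z system_matrix_mult by (force simp: algebra_simps)
  then show ?thesis
    by (simp add: noise_set_iff N_matrix_def inner_congruence E_matrix_mult vectorize_diff)
qed

text \<open>All four facts pull back from \<open>\<Phi>\<close>: on \<open>vectorize Y\<close> the
  lower block of \<open>N_matrix\<close> acts like that of \<open>\<Phi>\<close> on
  \<open>vectorize (Y ** ?\<Omega>)\<close>. The Kronecker structure turns this into a trace form of
  \<open>Q22\<close>, and rank-one \<open>Y\<close> recover statements about single vectors.\<close>

lemma N_matrix_properties:
  fixes u :: "nat \<Rightarrow> real^'m" and x :: "nat \<Rightarrow> real^'n"
    and \<Phi> :: "real^(1 + 't::{finite,linorder} \<times> 'n)^(1 + 't \<times> 'n)"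
  assumes \<Phi>: "\<Phi> \<in> Pi_set" and \<phi>: "symmetric_matrix \<phi>" and \<Phi>22: "block22 \<Phi> = \<phi> \<otimes>\<^sub>K mat 1"
  shows "symmetric_matrix (N_matrix u x \<Phi>)"
    and "block22 (N_matrix u x \<Phi>) = Q22 u x \<phi> \<otimes>\<^sub>K mat 1"
    and "Q22 u x \<phi> \<preceq> 0"
    and "{w. Q22 u x \<phi> *v w = 0} \<subseteq> {w. Q12 u x \<Phi> *v w = 0}"
proof -
  let ?N = "N_matrix u x \<Phi>" and ?R = "Q22 u x \<phi>" and ?L = "Q12 u x \<Phi>"
  let ?\<Omega> = "vstack (past x) (past u) :: real^'t::{finite,linorder}^('n + 'm)"
  have sym\<Phi>: "symmetric_matrix \<Phi>" and neg: "block22 \<Phi> \<preceq> 0"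
    and ker: "{v. block22 \<Phi> *v v = 0} \<subseteq> {v. block12 \<Phi> *v v = 0}"
    using \<Phi> by (auto simp: Pi_set_def)
  show symN: "symmetric_matrix ?N"
    unfolding N_matrix_def by (rule symmetric_congruence[OF sym\<Phi>])
  have symR: "symmetric_matrix ?R"
    using symmetric_congruence[OF \<phi>, of "transpose ?\<Omega>"] by (simp add: Q22_def)
  have \<Phi>22_mult: "block22 \<Phi> *v vectorize Y = vectorize (Y ** \<phi>)" for Y
    using \<phi> by (simp add: \<Phi>22 kronecker_mult_vectorize symmetric_matrix_def)
  have R_mult: "(?R \<otimes>\<^sub>K mat 1) *v vectorize Y = vectorize (Y ** ?R)" for Y :: "real^('n + 'm)^'n"
    using symR by (simp add: kronecker_mult_vectorize symmetric_matrix_def)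
  have N_form: "vec_pair 0 (vectorize Y) \<bullet> (?N *v vec_pair 0 (vectorize Y')) =
      vectorize (Y ** ?\<Omega>) \<bullet> (block22 \<Phi> *v vectorize (Y' ** ?\<Omega>))" for Y Y'
    unfolding N_matrix_def inner_congruence E_matrix_mult
    by (simp add: matrix_mult_vec_pair inner_vec_pair matrix_vector_mult_uminus)
  have N22_form: "y \<bullet> (block22 ?N *v y') = vec_pair 0 y \<bullet> (?N *v vec_pair 0 y')" for y y'
    by (simp add: matrix_mult_vec_pair inner_vec_pair)
  have inner_R: "(Y ** ?\<Omega>) \<bullet> (Y' ** ?\<Omega> ** \<phi>) = Y \<bullet> (Y' ** ?R)" for Y Y' :: "real^('n + 'm)^'n"
    by (simp add: inner_matrix_mult_left Q22_def matrix_mul_assoc)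
  show N22: "block22 ?N = ?R \<otimes>\<^sub>K mat 1"
  proof (rule iffD2[OF matrix_eq], rule allI)
    fix y'
    have "y \<bullet> (block22 ?N *v y') = y \<bullet> ((?R \<otimes>\<^sub>K mat 1) *v y')" for y
    proof -
      obtain Y Y' where y: "y = vectorize Y" "y' = vectorize Y'" by (metis vectorize_inverse(1))
      show ?thesis
        unfolding y N22_form N_form R_mult by (simp add: \<Phi>22_mult inner_vectorize inner_R)
    qed
    then show "block22 ?N *v y' = (?R \<otimes>\<^sub>K mat 1) *v y'" by (metis vector_eq_ldot)
  qed
  \<comment> \<open>A matrix whose only nonzero row is \<open>w\<close> isolates the form of
    \<open>?R\<close> at \<open>w\<close>, so its sign can be read off from
    \<open>block22 ?N\<close>.\<close>
  have outer_R: "w \<bullet> (?R *v w) =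
      vectorize (outer_product (axis i 1) w) \<bullet> (block22 ?N *v vectorize (outer_product (axis i 1) w))"
    for w and i :: 'n
    by (simp add: N22 R_mult inner_vectorize inner_matrix_mult_outer_product[OF symR] inner_axis_axis)
  have N22_nonpos: "y \<bullet> (block22 ?N *v y) \<le> 0" for y
  proof -
    obtain Y where y: "y = vectorize Y" by (metis vectorize_inverse(1))
    show ?thesis unfolding y N22_form N_form by (rule loewner_le_zeroD(2)[OF neg])
  qed
  have "w \<bullet> (?R *v w) \<le> 0" for w
    using N22_nonpos outer_R by metis
  moreover have "symmetric_matrix (- ?R)"
    using symR by (simp add: symmetric_matrix_def transpose_def vec_eq_iff)
  ultimately show "?R \<preceq> 0"
    by (simp add: loewner_le_def pos_semidef_def uminus_matrix_vector_mult)
  show "{w. ?R *v w = 0} \<subseteq> {w. ?L *v w = 0}"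
  proof clarify
    fix w assume w: "?R *v w = 0"
    \<comment> \<open>This number is the Frobenius product of \<open>outer_product a w\<close> with
      \<open>?L\<close>, hence a pairing with \<open>block21 ?N\<close>. It vanishes because
      \<open>E_matrix\<close> maps the vectorized outer product into the kernel of
      \<open>\<Phi>\<close>.\<close>
    have "a \<bullet> (?L *v w) = 0" for a
    proof -
      let ?Y = "outer_product a w"
      let ?t = "vec_pair 0 (- vectorize (?Y ** ?\<Omega>)) :: real^(1 + 't::{finite,linorder} \<times> 'n)"
      have E: "E_matrix u x *v vec_pair 0 (vectorize ?Y) = ?t"
        by (simp add: E_matrix_mult)
      have "vectorize ?Y \<bullet> (block22 ?N *v vectorize ?Y) = 0"
        by (simp add: N22 R_mult inner_vectorize inner_matrix_mult_outer_product[OF symR] w)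
      then have "vectorize (?Y ** ?\<Omega>) \<bullet> (block22 \<Phi> *v vectorize (?Y ** ?\<Omega>)) = 0"
        unfolding N22_form N_form .
      then have "block22 \<Phi> *v vectorize (?Y ** ?\<Omega>) = 0" by (rule loewner_le_zeroD(3)[OF neg])
      then have 0: "block22 \<Phi> *v (- vectorize (?Y ** ?\<Omega>)) = 0"
        by (simp add: matrix_vector_mult_uminus)
      then have "\<Phi> *v ?t = 0"
        using ker by (intro symmetric_matrix_null_pair[OF sym\<Phi>]) auto
      then have "vec_pair 1 0 \<bullet> (?N *v vec_pair 0 (vectorize ?Y)) = 0"
        by (simp add: N_matrix_def inner_congruence E)
      then have "vec_pair 0 (vectorize ?Y) \<bullet> (?N *v vec_pair 1 0) = 0"
        using symmetric_inner_commute[OF symN] by metis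
      then have "?Y \<bullet> ?L = 0"
        by (simp add: matrix_mult_vec_pair inner_vec_pair vec_Q12[symmetric] columnvector_mult_1
            inner_vectorize)
      then show ?thesis
        by (simp add: inner_vec_def[of _ ?L] inner_vec_def[of a] outer_product_row
            matrix_vector_mul_component inner_commute)
    qed
    then show "?L *v w = 0" by (metis inner_eq_zero_iff)
  qed
qed

section \<open>Informativity and the matrix inequality\<close>

theorem theorem3:
  fixes u :: "nat \<Rightarrow> real^'m"
    and x :: "nat \<Rightarrow> real^'n"
    and \<Phi> :: "real^(1 + 't::{finite,linorder} \<times> 'n)^(1 + 't \<times> 'n)"
    and \<phi> :: "real^'t::{finite,linorder}^'t::{finite,linorder}"
    and A\<^sub>s :: "real^'n^'n"
    and B\<^sub>s :: "real^'m^'n"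
    and \<Theta> :: "'a set"
    and M :: "'a \<Rightarrow> real^('n + ('n + 'm))^('n + ('n + 'm))"
  assumes "\<Phi> \<in> Pi_set"
    and "symmetric_matrix \<phi>"
    and "block22 \<Phi> = \<phi> \<otimes>\<^sub>K mat 1"
    and "(A\<^sub>s, B\<^sub>s) \<in> compatible_systems u x (noise_set \<Phi>)"
    and "\<And>\<theta>. \<theta> \<in> \<Theta> \<Longrightarrow> symmetric_matrix (M \<theta>)"
    and "\<And>\<theta>. \<theta> \<in> \<Theta> \<Longrightarrow> block22 (M \<theta>) \<preceq> 0"
  shows "informative u x (noise_set \<Phi>) \<Theta> M \<longleftrightarrow>
    (\<exists>\<theta>\<in>\<Theta>. \<exists>\<alpha> \<beta>. \<alpha> \<ge> 0 \<and> \<beta> > 0 \<and>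
       block_matrix (\<beta> *\<^sub>R mat 1) 0 0 0 \<preceq> M \<theta> - \<alpha> *\<^sub>R Q_matrix u x \<Phi> \<phi>)"
proof -
  let ?N = "N_matrix u x \<Phi>" and ?R = "Q22 u x \<phi>" and ?L = "Q12 u x \<Phi>" and ?Q = "Q_matrix u x \<Phi> \<phi>"
  note N = N_matrix_properties[OF assms(1-3), of u x]
  \<comment> \<open>The compatible \<open>Z\<close> form a ball in a seminorm, centred at
    \<open>- H\<close>, with squared radius \<open>s\<close>.\<close>
  define H where "H = ?L ** pseudoinverse ?R"
  define s where "s = schur ?N $ 1 $ 1"
  have symR: "symmetric_matrix ?R" by (rule loewner_le_zeroD(1)[OF N(3)])
  have HR: "H ** ?R = ?L" unfolding H_def by (rule mult_pseudoinverse_mult[OF N(4)])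
  have HT: "?L ** pseudoinverse ?R ** transpose ?L = ?L ** transpose H"
    using symmetric_pseudoinverse[OF symR]
    by (simp add: H_def matrix_transpose_mul symmetric_matrix_def matrix_mul_assoc)
  have Q: "?Q = block_matrix (s *\<^sub>R mat 1 + ?L ** transpose H) ?L (transpose ?L) ?R"
    by (simp add: Q_matrix_def s_def HT)
  have "symmetric_matrix (?L ** transpose H)"
    using symmetric_congruence[OF symmetric_pseudoinverse[OF symR], of "transpose ?L"]
    by (simp add: HT)
  then have "symmetric_matrix (s *\<^sub>R mat 1 + ?L ** transpose H)"
    by (simp add: symmetric_matrix_def transpose_def vec_eq_iff mat_def)
  then have symQ: "symmetric_matrix ?Q" unfolding Q by (rule symmetric_block_matrix) (rule symR)
  have Q_form: "vec_pair v w \<bullet> (?Q *v vec_pair v w) =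
      s * (v \<bullet> v) + (w + transpose H *v v) \<bullet> (?R *v (w + transpose H *v v))" for v w
    unfolding Q by (rule square_completion_vec[OF symR HR])
  have compatible: "(A, B) \<in> compatible_systems u x (noise_set \<Phi>) \<longleftrightarrow>
      0 \<le> s + (Z + H) \<bullet> ((Z + H) ** ?R)"
    if "Z = transpose (vstack (transpose A) (transpose B))" for A B Z
    unfolding compatible_systems_iff[OF that] s_def
    using square_completion_vectorize[OF N(1,2) vec_Q12[symmetric] symR HR] by simp
  \<comment> \<open>The true system is compatible, so the ball is nonempty; its trace term is
    nonpositive, which leaves \<open>s\<close> nonnegative.\<close>
  have s: "0 \<le> s"
  proof -
    let ?D = "transpose (vstack (transpose A\<^sub>s) (transpose B\<^sub>s)) + H"
    have "?D \<bullet> (?D ** ?R) \<le> 0"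
      unfolding inner_matrix_mult[OF symR] by (intro sum_nonpos loewner_le_zeroD(2)[OF N(3)])
    then show ?thesis using assms(4) compatible[OF refl] by simp
  qed
  let ?S = "\<lambda>A B. vstack (mat 1) (vstack (transpose A) (transpose B)) :: real^'n^('n + ('n + 'm))"
  have S: "?S A B *v v = vec_pair v (vstack (transpose A) (transpose B) *v v)" for A B v
    by (simp add: vstack_mult_vec)
  show ?thesis
  proof
    assume "informative u x (noise_set \<Phi>) \<Theta> M"
    then obtain \<theta> where \<theta>: "\<theta> \<in> \<Theta>" and inf: "\<And>A B. (A, B) \<in> compatible_systems u x (noise_set \<Phi>) \<Longrightarrow>
        pos_def (transpose (?S A B) ** M \<theta> ** ?S A B)"
      unfolding informative_def by blast
    have "0 < vec_pair v w \<bullet> (M \<theta> *v vec_pair v w)"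
      if v: "v \<noteq> 0" and w: "0 \<le> vec_pair v w \<bullet> (?Q *v vec_pair v w)" for v w
    proof -
      define d where "d = w + transpose H *v v"
      \<comment> \<open>The scaling by the squared norm of \<open>v\<close> makes
        \<open>transpose D\<close> send \<open>v\<close> to \<open>d\<close>. For this rank-one
        \<open>D\<close> the Frobenius bound is an equality, so the condition on
        \<open>(v, w)\<close> becomes compatibility of \<open>D - H\<close>.\<close>
      define D where "D = outer_product ((1 / (v \<bullet> v)) *\<^sub>R v) d"
      have vv: "v \<bullet> v > 0" using v by simp
      have Dv: "transpose D *v v = d"
        using vv by (simp add: D_def transpose_outer_product_mult)
      obtain A B where Z: "D - H = transpose (vstack (transpose A) (transpose B))"
        by (rule system_matrix_cases)
      have "D \<bullet> (D ** ?R) = (d \<bullet> (?R *v d)) / (v \<bullet> v)"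
        using vv by (simp add: D_def inner_matrix_mult_outer_product[OF symR])
      then have "(v \<bullet> v) * (s + D \<bullet> (D ** ?R)) = vec_pair v w \<bullet> (?Q *v vec_pair v w)"
        using vv by (simp add: Q_form d_def[symmetric] distrib_left)
      then have "0 \<le> s + D \<bullet> (D ** ?R)"
        using w vv by (metis zero_le_mult_iff not_less)
      then have "(A, B) \<in> compatible_systems u x (noise_set \<Phi>)"
        using compatible[OF Z] by simp
      from inf[OF this] v have "0 < (?S A B *v v) \<bullet> (M \<theta> *v (?S A B *v v))"
        by (simp add: pos_def_def inner_congruence)
      moreover have "vstack (transpose A) (transpose B) *v v = w"
      proof -
        have "vstack (transpose A) (transpose B) = transpose D - transpose H"
          using Z by (metis transpose_transpose transpose_minus)
        then show ?thesis
          by (simp add: matrix_vector_mult_diff_rdistrib Dv d_def)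
      qed
      ultimately show ?thesis by (simp add: S)
    qed
    \<comment> \<open>This \<open>w\<close> annihilates the completed square, leaving
      \<open>s * (v \<bullet> v)\<close>.\<close>
    moreover have "\<exists>w. 0 \<le> vec_pair v w \<bullet> (?Q *v vec_pair v w)" for v
      by (rule exI[of _ "- (transpose H *v v)"]) (use s in \<open>simp add: Q_form\<close>)
    ultimately have "\<exists>\<alpha>\<ge>0. \<exists>\<beta>>0. block_matrix (\<beta> *\<^sub>R mat 1) 0 0 0 \<preceq> M \<theta> - \<alpha> *\<^sub>R ?Q"
      using N(3,4) \<theta> assms(5,6) by (intro matrix_S_lemma symQ) (simp_all add: Q block_matrix_inverse)
    then show "\<exists>\<theta>\<in>\<Theta>. \<exists>\<alpha> \<beta>. \<alpha> \<ge> 0 \<and> \<beta> > 0 \<and>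
        block_matrix (\<beta> *\<^sub>R mat 1) 0 0 0 \<preceq> M \<theta> - \<alpha> *\<^sub>R ?Q"
      using \<theta> by blast
  next
    assume "\<exists>\<theta>\<in>\<Theta>. \<exists>\<alpha> \<beta>. \<alpha> \<ge> 0 \<and> \<beta> > 0 \<and>
        block_matrix (\<beta> *\<^sub>R mat 1) 0 0 0 \<preceq> M \<theta> - \<alpha> *\<^sub>R ?Q"
    then obtain \<theta> \<alpha> \<beta> where \<theta>: "\<theta> \<in> \<Theta>" and "\<alpha> \<ge> 0" "\<beta> > 0"
      and le: "block_matrix (\<beta> *\<^sub>R mat 1) 0 0 0 \<preceq> M \<theta> - \<alpha> *\<^sub>R ?Q" by blast
    have M_ge: "\<beta> * (v \<bullet> v) + \<alpha> * (vec_pair v w \<bullet> (?Q *v vec_pair v w)) \<le>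
        vec_pair v w \<bullet> (M \<theta> *v vec_pair v w)" for v w
    proof -
      let ?B = "block_matrix (\<beta> *\<^sub>R mat 1) 0 0 0 :: real^('n + ('n + 'm))^('n + ('n + 'm))"
      have B: "vec_pair v w \<bullet> (?B *v vec_pair v w) = \<beta> * (v \<bullet> v)"
        by (simp add: matrix_mult_vec_pair inner_vec_pair block_matrix_inverse
            scaleR_matrix_vector_assoc[symmetric])
      have "0 \<le> vec_pair v w \<bullet> ((M \<theta> - \<alpha> *\<^sub>R ?Q - ?B) *v vec_pair v w)"
        using le by (simp add: loewner_le_def pos_semidef_def)
      then show ?thesis
        by (simp add: matrix_vector_mult_diff_rdistrib inner_diff_right B
            scaleR_matrix_vector_assoc[symmetric])
    qed
    have "pos_def (transpose (?S A B) ** M \<theta> ** ?S A B)"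
      if AB: "(A, B) \<in> compatible_systems u x (noise_set \<Phi>)" for A B
      unfolding pos_def_def inner_congruence
    proof (intro conjI allI impI)
      show "symmetric_matrix (transpose (?S A B) ** M \<theta> ** ?S A B)"
        by (rule symmetric_congruence[OF assms(5)[OF \<theta>]])
      fix v :: "real^'n" assume v: "v \<noteq> 0"
      define Z where "Z = transpose (vstack (transpose A) (transpose B))"
      define w where "w = vstack (transpose A) (transpose B) *v v"
      have "transpose (Z + H) *v v = w + transpose H *v v"
        by (simp add: Z_def w_def transpose_plus matrix_vector_mult_add_rdistrib)
      \<comment> \<open>The Frobenius bound passes from compatibility of the whole matrix to a
        nonnegative \<open>Q\<close>-form at the single pair \<open>(v, w)\<close>.\<close>
      then have "(v \<bullet> v) * ((Z + H) \<bullet> ((Z + H) ** ?R)) \<le>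
          (w + transpose H *v v) \<bullet> (?R *v (w + transpose H *v v))"
        using frobenius_le_quadratic_form[OF N(3), of v "Z + H"] by simp
      moreover have "0 \<le> (v \<bullet> v) * (s + (Z + H) \<bullet> ((Z + H) ** ?R))"
        using AB compatible[OF Z_def] by simp
      ultimately have "0 \<le> vec_pair v w \<bullet> (?Q *v vec_pair v w)"
        unfolding Q_form by (simp add: algebra_simps)
      then have "0 \<le> \<alpha> * (vec_pair v w \<bullet> (?Q *v vec_pair v w))" using \<open>\<alpha> \<ge> 0\<close> by simp
      moreover have "0 < \<beta> * (v \<bullet> v)" using \<open>\<beta> > 0\<close> v by simp
      ultimately have "0 < vec_pair v w \<bullet> (M \<theta> *v vec_pair v w)" using M_ge[of v w] by linarith
      then show "0 < (?S A B *v v) \<bullet> (M \<theta> *v (?S A B *v v))" unfolding S w_def .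
    qed
    then show "informative u x (noise_set \<Phi>) \<Theta> M"
      using \<theta> unfolding informative_def by blast
  qed
qed

end
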